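(* Consider the update equation, given in the context, for the cell-averaged water depth $\bar h$. Suppose that the following conditions hold at time $t_n$: 1. $\bar h_{ij}^n\ge 0$, $h_{ij}^n(x_i^\beta,\hat y_j^r)\ge 0$ and $h_{ij}^n(\hat x_i^r,y_j^\beta)\ge 0$ for all $i,j,r,\beta$; 2. $\frac{\Delta t_n}{\Delta x}\alpha_1+\frac{\Delta t_n}{\Delta y}\alpha_2\le\hat\omega_1$, where $\alpha_1=\bigl\||u|+\sqrt{gh}\bigr\|_\infty$ and $\alpha_2=\bigl\||v|+\sqrt{gh}\bigr\|_\infty$. Then $\bar h_{ij}^{n+1}\ge 0$ for all $i=1,\dots,M_x$, $j=1,\dots,M_y$ at time $t_{n+1}$.
   Context: **Setting.** A discontinuous Galerkin (DG) method with polynomials of degree at most $k$ on each cell and forward Euler time stepping is applied to the two-dimensional shallow water equations with variable density; $h$ is the water depth, $u,v$ are the velocities in the $x$- and $y$-directions, $g$ is the gravitational acceleration. **Mesh.** A rectangle is uniformly partitioned into cells $C_{ij}=I_i\times J_j$, with $I_i=[x_{i-1/2},x_{i+1/2}]$ of length $\Delta x$ ($1\le i\le M_x$) and $J_j=[y_{j-1/2},y_{j+1/2}]$ of length $\Delta y$ ($1\le j\le M_y$). $\Delta t_n=t_{n+1}-t_n$ is the time step. $h_{ij}^n$ is the DG solution polynomial for the water depth on $C_{ij}$ at time $t_n$, and $\bar h_{ij}^n$ is its average over $C_{ij}$. Superscripts $\pm$ on $x_{i\pm1/2}$, $y_{j\pm1/2}$ denote one-sided limits (from the right/above for $+$, from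 the left/below for $-$). **Quadrature.** $\{x_i^\beta\}_{\beta=1}^L$ and $\{y_j^\beta\}_{\beta=1}^L$ are the Gaussian quadrature points on $I_i$ and $J_j$; the corresponding weights $\omega_\beta$ (for the interval $[-1/2,1/2]$) satisfy $\sum_{\beta=1}^L\omega_\beta=1$. $\{\hat x_i^r\}_{r=1}^M$ and $\{\hat y_j^r\}_{r=1}^M$ are the Gauss–Lobatto quadrature points on $I_i$ and $J_j$; the corresponding weights $\hat\omega_r$ (for the interval $[-1/2,1/2]$) satisfy $\sum_{r=1}^M\hat\omega_r=1$, and $M$ satisfies $2M-3>k$. **Update of the cell average.** Taking a constant test function in the DG scheme gives $$\bar h_{ij}^{n+1}=\bar h_{ij}^n-\frac{\Delta t_n}{\Delta x\Delta y}\int_{J_j}\bigl[\hat f_{i+1/2}(y)-\hat f_{i-1/2}(y)\bigr]dy-\frac{\Delta t_n}{\Delta x\Delta y}\int_{I_i}\bigl[\hat g_{j+1/2}(x)-\hat g_{j-1/2}(x)\bigr]dx,$$ where the Lax–Friedrichs fluxes are $$\hat f_{i\pm1/2}(y)=\tfrac12\bigl[hu(x_{i\pm1/2}^-,y)+hu(x_{i\pm1/2}^+,y)-\alpha_1\bigl(h(x_{i\pm1/2}^+,y)-h(x_{i\pm1/2}^-,y)\bigr)\bigr],$$ $$\hat g_{j\pm1/2}(x)=\tfrac12\bigl[hv(x,y_{j\pm1/2}^-)+hv(x,y_{j\pm1/2}^+)-\alpha_2\bigl(h(x,y_{j\pm1/2}^+)-h(x,y_{j\pm1/2}^-)\bigr)\bigr],$$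 with all quantities on the right-hand sides taken from the numerical solution at time $t_n$.
   Formalization: Adds k ≤ 2L−1 (the L-point Gauss rule is exact for degree k; false otherwise); exterior states at the boundary are degree-k polynomials with h ≥ 0 at edge Gauss points and count in the sup norms, which are finite and taken where h ≥ 0. *)

theory Defs
  imports "HOL-Analysis.Analysis" "HOL-Computational_Algebra.Polynomial"
begin

section \<open>Quadrature rules on the reference interval\<close>

text \<open>
  Nodes and weights are indexed from 1 and refer to the interval $[-1/2,1/2]$.
  An $L$-point rule is Gaussian if it has the maximal degree of exactness $2L-1$; an
  $M$-point rule is Gauss--Lobatto if it uses both endpoints and has the maximal degree of
  exactness $2M-3$ that is then possible. Either condition determines nodes and weights
  uniquely. That the weights sum to 1 is exactness for constants.
\<close>

definition gauss_rule :: "nat \<Rightarrow> (nat \<Rightarrow> real) \<Rightarrow> (nat \<Rightarrow> real) \<Rightarrow> bool" where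
  "gauss_rule L \<xi> \<omega> \<longleftrightarrow>
     L \<ge> 1 \<and> strict_mono_on {1..L} \<xi> \<and> \<xi> ` {1..L} \<subseteq> {-1/2..1/2} \<and>
     (\<forall>p :: real poly. degree p \<le> 2 * L - 1 \<longrightarrow>
        (\<Sum>\<beta>=1..L. \<omega> \<beta> * poly p (\<xi> \<beta>)) = integral {-1/2..1/2} (poly p))"

definition gauss_lobatto_rule :: "nat \<Rightarrow> (nat \<Rightarrow> real) \<Rightarrow> (nat \<Rightarrow> real) \<Rightarrow> bool" where
  "gauss_lobatto_rule M \<xi> \<omega> \<longleftrightarrow>
     M \<ge> 2 \<and> strict_mono_on {1..M} \<xi> \<and> \<xi> 1 = -1/2 \<and> \<xi> M = 1/2 \<and>
     (\<forall>p :: real poly. degree p \<le> 2 * M - 3 \<longrightarrow>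
        (\<Sum>r=1..M. \<omega> r * poly p (\<xi> r)) = integral {-1/2..1/2} (poly p))"


section \<open>Uniform mesh\<close>

text \<open>
  One coordinate direction with left end \<open>a\<close> and mesh width \<open>d\<close>. The point \<open>face a d i\<close>
  is $x_{i+1/2}$, so cell \<open>i\<close> is $[x_{i-1/2},x_{i+1/2}]$ and the cells of the mesh are
  \<open>1, \<dots>, N\<close>. Indices are integers because the ghost cells \<open>0\<close> and \<open>N + 1\<close>
  carry the exterior states that enter the fluxes at the boundary of the domain.
\<close>

definition face :: "real \<Rightarrow> real \<Rightarrow> int \<Rightarrow> real" where
  "face a d i = a + of_int i * d"

definition cell :: "real \<Rightarrow> real \<Rightarrow> int \<Rightarrow> real set" where
  "cell a d i = {face a d (i - 1)..face a d i}"

text \<open>The image in cell \<open>i\<close> of the point \<open>\<xi>\<close> of the reference interval.\<close>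

definition node :: "real \<Rightarrow> real \<Rightarrow> int \<Rightarrow> real \<Rightarrow> real" where
  "node a d i \<xi> = (face a d (i - 1) + face a d i) / 2 + d * \<xi>"

definition mesh_cells :: "nat \<Rightarrow> nat \<Rightarrow> (int \<times> int) set" where
  "mesh_cells Mx My = {1..int Mx} \<times> {1..int My}"

text \<open>The mesh together with the ghost cells sharing an edge with it (no corners).\<close>

definition state_cells :: "nat \<Rightarrow> nat \<Rightarrow> (int \<times> int) set" where
  "state_cells Mx My =
     {0..int Mx + 1} \<times> {1..int My} \<union> {1..int Mx} \<times> {0..int My + 1}"


section \<open>Piecewise functions, averages and traces\<close>

text \<open>
  \<open>q i j x y\<close> is the value at \<open>(x, y)\<close> of the restriction of \<open>q\<close> to the closed cell
  \<open>(i, j)\<close>; only arguments in that cell matter.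
\<close>

type_synonym dgfun = "int \<Rightarrow> int \<Rightarrow> real \<Rightarrow> real \<Rightarrow> real"

definition mult_dg :: "dgfun \<Rightarrow> dgfun \<Rightarrow> dgfun" where
  "mult_dg p q = (\<lambda>i j x y. p i j x y * q i j x y)"

text \<open>Polynomials in two variables of total degree at most \<open>k\<close>.\<close>

definition polynomial2_on ::
    "nat \<Rightarrow> real set \<Rightarrow> real set \<Rightarrow> (real \<Rightarrow> real \<Rightarrow> real) \<Rightarrow> bool" where
  "polynomial2_on k I J f \<longleftrightarrow>
     (\<exists>c :: nat \<Rightarrow> nat \<Rightarrow> real. \<forall>x\<in>I. \<forall>y\<in>J.
        f x y = (\<Sum>a\<le>k. \<Sum>b\<le>k - a. c a b * x ^ a * y ^ b))"

definition cell_average ::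
    "real \<Rightarrow> real \<Rightarrow> real \<Rightarrow> real \<Rightarrow> dgfun \<Rightarrow> int \<Rightarrow> int \<Rightarrow> real" where
  "cell_average a dx b dy q i j =
     integral (cell a dx i \<times> cell b dy j) (\<lambda>(x, y). q i j x y) / (dx * dy)"

text \<open>
  One-sided limits at $x_{i+1/2}$ and $y_{j+1/2}$. To the left of $x_{i+1/2}$ lies cell \<open>i\<close>,
  to the right cell \<open>i + 1\<close>.
\<close>

definition trace_xm :: "real \<Rightarrow> real \<Rightarrow> dgfun \<Rightarrow> int \<Rightarrow> int \<Rightarrow> real \<Rightarrow> real" where
  "trace_xm a dx q i j y = Lim (at_left (face a dx i)) (\<lambda>x. q i j x y)"

definition trace_xp :: "real \<Rightarrow> real \<Rightarrow> dgfun \<Rightarrow> int \<Rightarrow> int \<Rightarrow> real \<Rightarrow> real" where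
  "trace_xp a dx q i j y = Lim (at_right (face a dx i)) (\<lambda>x. q (i + 1) j x y)"

definition trace_ym :: "real \<Rightarrow> real \<Rightarrow> dgfun \<Rightarrow> int \<Rightarrow> int \<Rightarrow> real \<Rightarrow> real" where
  "trace_ym b dy q i j x = Lim (at_left (face b dy j)) (\<lambda>y. q i j x y)"

definition trace_yp :: "real \<Rightarrow> real \<Rightarrow> dgfun \<Rightarrow> int \<Rightarrow> int \<Rightarrow> real \<Rightarrow> real" where
  "trace_yp b dy q i j x = Lim (at_right (face b dy j)) (\<lambda>y. q i (j + 1) x y)"


section \<open>Lax--Friedrichs fluxes\<close>

text \<open>\<open>flux_x \<dots> i j\<close> is the flux $\hat f_{i+1/2}$ on the edge $x = x_{i+1/2}$, $y \in J_j$;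
  \<open>flux_y \<dots> i j\<close> is $\hat g_{j+1/2}$ on the edge $y = y_{j+1/2}$, $x \in I_i$.\<close>

definition flux_x ::
    "real \<Rightarrow> real \<Rightarrow> real \<Rightarrow> dgfun \<Rightarrow> dgfun \<Rightarrow> int \<Rightarrow> int \<Rightarrow> real \<Rightarrow> real" where
  "flux_x a dx \<alpha> h u i j y =
     1/2 * (trace_xm a dx (mult_dg h u) i j y + trace_xp a dx (mult_dg h u) i j y
            - \<alpha> * (trace_xp a dx h i j y - trace_xm a dx h i j y))"

definition flux_y ::
    "real \<Rightarrow> real \<Rightarrow> real \<Rightarrow> dgfun \<Rightarrow> dgfun \<Rightarrow> int \<Rightarrow> int \<Rightarrow> real \<Rightarrow> real" where
  "flux_y b dy \<alpha> h v i j x =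
     1/2 * (trace_ym b dy (mult_dg h v) i j x + trace_yp b dy (mult_dg h v) i j x
            - \<alpha> * (trace_yp b dy h i j x - trace_ym b dy h i j x))"

text \<open>
  The values of $|w| + \sqrt{g h}$ for a velocity component \<open>w\<close>. These are nonnegative, so
  their supremum is the sup norm. Points with negative depth, where the square root is
  undefined, are left out. Exterior states are included, as they enter the fluxes.
\<close>

definition wave_speeds ::
    "real \<Rightarrow> real \<Rightarrow> nat \<Rightarrow> real \<Rightarrow> real \<Rightarrow> nat \<Rightarrow> real \<Rightarrow> dgfun \<Rightarrow> dgfun \<Rightarrow> real set" where
  "wave_speeds a dx Mx b dy My g h w =
     {\<bar>w i j x y\<bar> + sqrt (g * h i j x y) | i j x y.
        (i, j) \<in> state_cells Mx My \<and> x \<in> cell a dx i \<and> y \<in> cell b dy j \<and> 0 \<le> h i j x y}"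

end

theory Submission
  imports Defs
begin

text \<open>
  Since \<open>\<bar>hu\<bar> \<le> \<alpha> h\<close> at the edges, the Lax--Friedrichs flux out of a cell through an edge is at
  most \<open>\<alpha>\<close> times the inner trace of the depth. Hence in each coordinate direction the update
  lowers the cell average by at most \<open>dt \<alpha> / d\<close> times the sum of the averages of the depth over
  two opposite edges. Tensor quadrature (Gauss along the edge, Gauss--Lobatto across) is exact for
  the cell average and has positive weights, so the cell average is at least \<open>\<omega>h 1\<close> times that
  sum. The CFL condition leaves a nonnegative remainder.
\<close>

section \<open>Quadrature weights\<close>

text \<open>The common core of Gauss and Gauss-Lobatto rules, so that positivity of weights and
  transfer to a cell are treated once for both. The location of the nodes is kept because the data
  are polynomial only on the cell itself.\<close>

definition exact_rule :: "nat \<Rightarrow> nat \<Rightarrow> (nat \<Rightarrow> real) \<Rightarrow> (nat \<Rightarrow> real) \<Rightarrow> bool" where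
  "exact_rule n N \<xi> \<omega> \<longleftrightarrow> \<xi> ` {1..N} \<subseteq> {-1/2..1/2} \<and>
     (\<forall>p :: real poly. degree p \<le> n \<longrightarrow>
        (\<Sum>r=1..N. \<omega> r * poly p (\<xi> r)) = integral {-1/2..1/2} (poly p))"

lemma exact_rule_mono: "exact_rule n N \<xi> \<omega> \<Longrightarrow> m \<le> n \<Longrightarrow> exact_rule m N \<xi> \<omega>"
  by (auto simp: exact_rule_def)

lemma exact_rule_node: "exact_rule n N \<xi> \<omega> \<Longrightarrow> r \<in> {1..N} \<Longrightarrow> \<xi> r \<in> {-1/2..1/2}"
  unfolding exact_rule_def by blast

lemma gauss_rule_exact: "gauss_rule L \<xi> \<omega> \<Longrightarrow> exact_rule (2 * L - 1) L \<xi> \<omega>"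
  by (simp add: gauss_rule_def exact_rule_def)

lemma gauss_lobatto_rule_exact:
  assumes "gauss_lobatto_rule M \<zeta> \<omega>h"
  shows "exact_rule (2 * M - 3) M \<zeta> \<omega>h"
proof -
  have m: "M \<ge> 2" "strict_mono_on {1..M} \<zeta>" "\<zeta> 1 = -1/2" "\<zeta> M = 1/2"
    using assms by (auto simp: gauss_lobatto_rule_def)
  have "\<zeta> r \<in> {-1/2..1/2}" if "r \<in> {1..M}" for r
  proof -
    have "\<zeta> 1 \<le> \<zeta> r" "\<zeta> r \<le> \<zeta> M"
      using that m(1) strict_mono_on_imp_mono_on[OF m(2)] by (auto elim!: mono_onD)
    with m show ?thesis by simp
  qed
  with assms show ?thesis by (auto simp: gauss_lobatto_rule_def exact_rule_def)
qed

text \<open>The test polynomial \<open>p\<close> isolates one weight: the quadrature sum collapses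
  to \<open>\<omega> r * poly p (\<xi> r)\<close> and equals the integral of \<open>p\<close>. That
  integral is positive, since a nonnegative continuous function with zero integral would vanish at
  \<open>\<xi> r\<close> too.\<close>

lemma exact_rule_weight_pos:
  assumes ex: "exact_rule n N \<xi> \<omega>" and r: "r \<in> {1..N}"
    and deg: "degree p \<le> n"
    and zero: "\<And>s. s \<in> {1..N} \<Longrightarrow> s \<noteq> r \<Longrightarrow> poly p (\<xi> s) = 0"
    and pos: "poly p (\<xi> r) > 0"
    and nonneg: "\<And>x. x \<in> {-1/2..1/2} \<Longrightarrow> poly p x \<ge> 0"
  shows "\<omega> r > 0"
proof -
  have "(\<Sum>s=1..N. \<omega> s * poly p (\<xi> s)) = (\<Sum>s\<in>{r}. \<omega> s * poly p (\<xi> s))"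
    by (rule sum.mono_neutral_right) (use r zero in auto)
  then have eq: "\<omega> r * poly p (\<xi> r) = integral {-1/2..1/2} (poly p)"
    using ex deg by (simp add: exact_rule_def)
  have cont: "continuous_on {-1/2..1/2} (poly p)"
    by (intro continuous_intros)
  have \<xi>r: "\<xi> r \<in> {-1/2..1/2}"
    using exact_rule_node[OF ex r] .
  have "integral {-1/2..1/2} (poly p) \<noteq> 0"
    using integral_eq_0_iff[OF cont] nonneg pos \<xi>r by force
  moreover have "integral {-1/2..1/2} (poly p) \<ge> 0"
    using nonneg by (intro integral_nonneg integrable_continuous_real cont) auto
  ultimately have "\<omega> r * poly p (\<xi> r) > 0"
    using eq by linarith
  with pos show ?thesis by (simp add: zero_less_mult_iff)
qed

section \<open>Nodal polynomials and the weights they isolate\<close>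

definition node_poly :: "nat set \<Rightarrow> (nat \<Rightarrow> real) \<Rightarrow> real poly" where
  "node_poly S \<xi> = (\<Prod>s\<in>S. [:- \<xi> s, 1:])"

lemma poly_node_poly: "poly (node_poly S \<xi>) x = (\<Prod>s\<in>S. x - \<xi> s)"
  by (simp add: node_poly_def poly_prod)

lemma degree_node_poly_le: "degree (node_poly S \<xi>) \<le> card S"
proof (cases "finite S")
  case True
  have "degree (node_poly S \<xi>) \<le> sum (degree \<circ> (\<lambda>s. [:- \<xi> s, 1:])) S"
    unfolding node_poly_def by (rule degree_prod_sum_le[OF True])
  then show ?thesis by simp
qed (simp add: node_poly_def)

lemma poly_node_poly_eq_0: "finite S \<Longrightarrow> s \<in> S \<Longrightarrow> poly (node_poly S \<xi>) (\<xi> s) = 0"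
  by (auto simp: poly_node_poly)

lemma poly_node_poly_neq_0:
  "finite S \<Longrightarrow> inj_on \<xi> T \<Longrightarrow> S \<subseteq> T \<Longrightarrow> r \<in> T - S \<Longrightarrow> poly (node_poly S \<xi>) (\<xi> r) \<noteq> 0"
  by (auto simp: poly_node_poly dest: inj_onD)

lemma degree_mult_square_le:
  fixes p q :: "real poly"
  shows "degree (q * p\<^sup>2) \<le> degree q + 2 * degree p"
  by (metis degree_mult_le degree_power_le le_trans add_le_cancel_left mult.commute)

text \<open>The test polynomial is the square of the nodal polynomial of the other nodes, of degree
  at most 2(L - 1).\<close>

lemma gauss_rule_weight_pos:
  assumes "gauss_rule L \<xi> \<omega>" and r: "r \<in> {1..L}"
  shows "\<omega> r > 0"
proof -
  let ?S = "{1..L} - {r}"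
  have inj: "inj_on \<xi> {1..L}"
    using assms by (auto simp: gauss_rule_def strict_mono_on_imp_inj_on)
  have "card ?S = L - 1" using r by simp
  \<comment> \<open>The factor 1 only gives the test polynomial the shape \<open>q * p^2\<close> of
    the degree bound.\<close>
  then have d: "degree (1 * (node_poly ?S \<xi>)\<^sup>2) \<le> 2 * L - 1"
    using degree_mult_square_le[of 1 "node_poly ?S \<xi>"] degree_node_poly_le[of ?S \<xi>] by simp
  have nz: "poly (node_poly ?S \<xi>) (\<xi> r) \<noteq> 0"
    by (rule poly_node_poly_neq_0[OF _ inj]) (use r in auto)
  show ?thesis
    by (rule exact_rule_weight_pos[OF gauss_rule_exact[OF assms(1)] r d])
      (use nz in \<open>auto simp: poly_node_poly_eq_0\<close>)
qed

text \<open>A squared nodal polynomial of all other nodes can exceed degree 2M - 3. Hence only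
  interior nodes are squared; end nodes other than \<open>r\<close> are removed by factors 1/2 - x
  and 1/2 + x, which are nonnegative on the interval without squaring.\<close>

lemma gauss_lobatto_weight_pos:
  assumes gl: "gauss_lobatto_rule M \<zeta> \<omega>h" and r: "r \<in> {1..M}"
  shows "\<omega>h r > 0"
proof -
  have M: "M \<ge> 2" and sm: "strict_mono_on {1..M} \<zeta>" and e: "\<zeta> 1 = -1/2" "\<zeta> M = 1/2"
    using gl by (auto simp: gauss_lobatto_rule_def)
  have inj: "inj_on \<zeta> {1..M}"
    using sm by (rule strict_mono_on_imp_inj_on)
  note ex = gauss_lobatto_rule_exact[OF gl]
  let ?S = "{2..M-1} - {r}"
  let ?w = "node_poly ?S \<zeta>"
  have nz: "poly ?w (\<zeta> r) \<noteq> 0"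
    by (rule poly_node_poly_neq_0[OF _ inj]) (use r in auto)
  have z: "poly ?w (\<zeta> s) = 0" if "s \<in> {1..M}" "s \<noteq> r" "s \<noteq> 1" "s \<noteq> M" for s
    using that by (intro poly_node_poly_eq_0) auto
  consider "r = 1" | "r = M" | "r \<in> {2..M-1}" using r by force
  then show ?thesis
  proof cases
    case 1
    have "card ?S = M - 2" using 1 M by simp
    \<comment> \<open>The factor 1/2 - x kills the right end node. The degree is at most 1 + 2(M -
      2) = 2M - 3, exactly what the rule permits.\<close>
    then have d: "degree ([:1/2, -1:] * ?w\<^sup>2) \<le> 2 * M - 3"
      using order_trans[OF degree_mult_square_le[of "[:1/2, -1:]" ?w]] degree_node_poly_le[of ?S \<zeta>] M
      by (auto simp del: mult_pCons_left)
    show ?thesis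
    proof (rule exact_rule_weight_pos[OF ex r d])
      show "poly ([:1/2, -1:] * ?w\<^sup>2) (\<zeta> s) = 0" if "s \<in> {1..M}" "s \<noteq> r" for s
        using z[OF that] e 1 that by (cases "s = M") auto
    show "0 \<le> poly ([:1/2, -1:] * ?w\<^sup>2) x" if "x \<in> {-1/2..1/2}" for x
        unfolding poly_mult using that by simp
    qed (use nz e 1 in auto)
  next
    case 2
    have "card ?S = M - 2" using 2 M by simp
    then have d: "degree ([:1/2, 1:] * ?w\<^sup>2) \<le> 2 * M - 3"
      using order_trans[OF degree_mult_square_le[of "[:1/2, 1:]" ?w]] degree_node_poly_le[of ?S \<zeta>] M
      by (auto simp del: mult_pCons_left)
    show ?thesis
    proof (rule exact_rule_weight_pos[OF ex r d])
      show "poly ([:1/2, 1:] * ?w\<^sup>2) (\<zeta> s) = 0" if "s \<in> {1..M}" "s \<noteq> r" for s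
        using z[OF that] e 2 that by (cases "s = 1") auto
    show "0 \<le> poly ([:1/2, 1:] * ?w\<^sup>2) x" if "x \<in> {-1/2..1/2}" for x
        unfolding poly_mult using that by simp
    show "0 < poly ([:1/2, 1:] * ?w\<^sup>2) (\<zeta> r)"
        unfolding poly_mult using nz by (simp add: 2 e)
    qed
  next
    case 3
    have "card ?S = M - 3" using 3 by simp
    \<comment> \<open>The factor 1/4 - x^2 kills both end nodes; here M is at least 3 and the degree
      is at most 2 + 2(M - 3).\<close>
    then have d: "degree ([:1/4, 0, -1:] * ?w\<^sup>2) \<le> 2 * M - 3"
      using order_trans[OF degree_mult_square_le[of "[:1/4, 0, -1:]" ?w]] degree_node_poly_le[of ?S \<zeta>] 3
      by (auto simp del: mult_pCons_left)
    have fac: "poly [:1/4, 0, -1:] x = (1/2 - x) * (1/2 + x)" for x :: real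
      by (simp add: algebra_simps)
    have "\<zeta> 1 < \<zeta> r" "\<zeta> r < \<zeta> M"
      using 3 strict_mono_onD[OF sm] by auto
    then have pos: "poly [:1/4, 0, -1:] (\<zeta> r) > 0"
      unfolding fac using e by simp
    show ?thesis
    proof (rule exact_rule_weight_pos[OF ex r d])
      show "poly ([:1/4, 0, -1:] * ?w\<^sup>2) (\<zeta> s) = 0" if "s \<in> {1..M}" "s \<noteq> r" for s
        using z[OF that] e that unfolding poly_mult fac by (cases "s = 1 \<or> s = M") auto
      show "0 < poly ([:1/4, 0, -1:] * ?w\<^sup>2) (\<zeta> r)"
        unfolding poly_mult using pos nz by simp
      show "0 \<le> poly ([:1/4, 0, -1:] * ?w\<^sup>2) x" if "x \<in> {-1/2..1/2}" for x
        unfolding poly_mult fac using that by simp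
    qed
  qed
qed

text \<open>The time step condition mentions only \<open>\<omega>h 1\<close>, but the edge at the
  right end carries \<open>\<omega>h M\<close>. Symmetry is not built into
  \<open>gauss_lobatto_rule\<close> and is derived from exactness.\<close>

lemma gauss_lobatto_end_weights_eq:
  assumes gl: "gauss_lobatto_rule M \<zeta> \<omega>h"
  shows "\<omega>h M = \<omega>h 1"
proof -
  have M: "M \<ge> 2" and sm: "strict_mono_on {1..M} \<zeta>" and e: "\<zeta> 1 = -1/2" "\<zeta> M = 1/2"
    using gl by (auto simp: gauss_lobatto_rule_def)
  have inj: "inj_on \<zeta> {1..M}"
    using sm by (rule strict_mono_on_imp_inj_on)
  let ?w = "node_poly {2..M-1} \<zeta>"
  \<comment> \<open>\<open>x w(x) w(-x)\<close> is odd and of degree at most \<open>2M - 3\<close>, so its quadrature sum vanishes;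
      only the end nodes contribute to it.\<close>
  define q where "q = [:0, 1:] * (?w * (?w \<circ>\<^sub>p [:0, -1:]))"
  have q: "poly q x = x * (poly ?w x * poly ?w (- x))" for x
    by (simp add: q_def poly_pcompose)
  have "degree ?w \<le> M - 2"
    using degree_node_poly_le[of "{2..M-1}" \<zeta>] by simp
  moreover have "degree (?w * (?w \<circ>\<^sub>p [:0, -1:])) \<le> degree ?w + degree ?w"
    using degree_mult_le[of ?w "?w \<circ>\<^sub>p [:0, -1:]"] by (simp add: degree_pcompose)
  ultimately have "degree q \<le> 2 * M - 3"
    using degree_mult_le[of "[:0, 1:]" "?w * (?w \<circ>\<^sub>p [:0, -1:])"] M
    unfolding q_def degree_pCons_eq_if by simp linarith
  then have "(\<Sum>r=1..M. \<omega>h r * poly q (\<zeta> r)) = integral {-1/2..1/2} (poly q)"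
    using gl by (simp add: gauss_lobatto_rule_def)
  also have "integral {-1/2..1/2} (poly q) = 0"
  proof -
    have "integral {-1/2..1/2} (poly q) = integral {-1/2..1/2} (\<lambda>x. poly q (- x))"
      using Henstock_Kurzweil_Integration.integral_reflect_real[of "1/2" "-1/2" "poly q"] by simp
    also have "(\<lambda>x. poly q (- x)) = (\<lambda>x. - poly q x)"
      by (simp add: q fun_eq_iff mult.commute)
    finally show ?thesis by simp
  qed
  also have "(\<Sum>r=1..M. \<omega>h r * poly q (\<zeta> r)) = (\<Sum>r\<in>{1,M}. \<omega>h r * poly q (\<zeta> r))"
  proof (rule sum.mono_neutral_right)
    show "\<forall>r\<in>{1..M} - {1, M}. \<omega>h r * poly q (\<zeta> r) = 0"
    proof
      fix r assume "r \<in> {1..M} - {1, M}"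
      then have "poly ?w (\<zeta> r) = 0" by (intro poly_node_poly_eq_0) auto
      then show "\<omega>h r * poly q (\<zeta> r) = 0" by (simp add: q)
    qed
  qed (use M in auto)
  \<comment> \<open>\<open>q\<close> takes opposite values at the two end nodes, so the remaining
    sum is half of this product.\<close>
  finally have "(\<omega>h M - \<omega>h 1) * (poly ?w (\<zeta> 1) * poly ?w (\<zeta> M)) = 0"
    using M by (simp add: q e e[simplified] algebra_simps)
  moreover have "poly ?w (\<zeta> 1) \<noteq> 0" "poly ?w (\<zeta> M) \<noteq> 0"
    by (rule poly_node_poly_neq_0[OF _ inj]; use M in auto)+
  ultimately show ?thesis by simp
qed


section \<open>Quadrature and traces on a cell\<close>

text \<open>Agreement is required on \<open>S\<close> only, because a \<open>dgfun\<close> is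
  arbitrary outside its cell.\<close>

definition poly_on :: "nat \<Rightarrow> real set \<Rightarrow> (real \<Rightarrow> real) \<Rightarrow> bool" where
  "poly_on k S F \<longleftrightarrow> (\<exists>p. degree p \<le> k \<and> (\<forall>x\<in>S. F x = poly p x))"

lemma poly_on_cong: "poly_on k S F \<Longrightarrow> (\<And>x. x \<in> S \<Longrightarrow> G x = F x) \<Longrightarrow> poly_on k S G"
  by (auto simp: poly_on_def)

lemma poly_on_diff: "poly_on k S F \<Longrightarrow> poly_on k S G \<Longrightarrow> poly_on k S (\<lambda>x. F x - G x)"
  unfolding poly_on_def by (metis degree_diff_le poly_diff)

lemma poly_on_add: "poly_on k S F \<Longrightarrow> poly_on k S G \<Longrightarrow> poly_on k S (\<lambda>x. F x + G x)"
  unfolding poly_on_def by (metis degree_add_le poly_add)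

lemma poly_on_cmult: "poly_on k S F \<Longrightarrow> poly_on k S (\<lambda>x. c * F x)"
  unfolding poly_on_def by (metis degree_smult_le le_trans poly_smult)

lemma poly_on_sum:
  assumes "\<And>r. r \<in> A \<Longrightarrow> poly_on k S (F r)"
  shows "poly_on k S (\<lambda>x. \<Sum>r\<in>A. F r x)"
  using assms
proof (induction A rule: infinite_finite_induct)
  case (insert r A)
  then show ?case by (simp add: poly_on_add)
qed (auto simp: poly_on_def intro!: exI[of _ 0])

lemma poly_on_power: "n \<le> k \<Longrightarrow> poly_on k S (\<lambda>x. x ^ n)"
  unfolding poly_on_def by (rule exI[of _ "monom 1 n"]) (simp add: poly_monom degree_monom_eq)

lemma poly_on_continuous: "poly_on k S F \<Longrightarrow> continuous_on S F"
  unfolding poly_on_def by (metis continuous_on_cong continuous_on_poly continuous_on_id)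

section \<open>Transfer of rules from the reference interval to a cell\<close>

lemma node_in_cell:
  assumes "0 < d" "t \<in> {-1/2..1/2}"
  shows "node a d i t \<in> cell a d i"
proof -
  have "d * t \<le> d * (1/2)" "d * (-1/2) \<le> d * t"
    by (rule mult_left_mono; use assms in auto)+
  then show ?thesis
    by (simp add: node_def cell_def face_def field_simps)
qed

lemma node_ends: "node a d i (-1/2) = face a d (i - 1)" "node a d i (1/2) = face a d i"
  by (simp_all add: node_def face_def field_simps)

lemma face_less: "0 < d \<Longrightarrow> face a d (i - 1) < face a d i"
  by (simp add: face_def algebra_simps)

text \<open>Pulling \<open>F\<close> back along the affine map \<open>node a d i\<close> preserves
  the degree bound, so exactness on the reference interval applies; the Jacobian is
  \<open>d\<close>.\<close>

lemma integral_cell_eq: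
  assumes d: "0 < d" and ex: "exact_rule k N \<xi> \<omega>" and F: "poly_on k (cell a d i) F"
  shows "integral (cell a d i) F = d * (\<Sum>r=1..N. \<omega> r * F (node a d i (\<xi> r)))"
proof -
  obtain p where p: "degree p \<le> k" "\<And>x. x \<in> cell a d i \<Longrightarrow> F x = poly p x"
    using F by (auto simp: poly_on_def)
  define m where "m = (face a d (i - 1) + face a d i) / 2"
  define P where "P = p \<circ>\<^sub>p [:m, d:]"
  have P: "poly P x = poly p (node a d i x)" for x
    by (simp add: P_def poly_pcompose node_def m_def mult.commute)
  have "degree P \<le> k" using p(1) d by (simp add: P_def degree_pcompose)
  have "((poly P) has_integral integral {-1/2..1/2} (poly P)) (cbox (-1/2) (1/2))"
    by (simp add: integrable_integral integrable_continuous_real continuous_on_poly)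
  \<comment> \<open>Substitution t = (x - m)/d: the slope \<open>1/d\<close> produces the factor
    \<open>d\<close>, and \<open>P\<close> turns back into \<open>p\<close>.\<close>
  then have "((\<lambda>x. poly P ((1/d) *\<^sub>R x + - (m / d))) has_integral
      (1 / \<bar>1/d\<bar> ^ DIM(real)) *\<^sub>R integral {-1/2..1/2} (poly P))
      ((\<lambda>x. (1 / (1/d)) *\<^sub>R x + - ((1 / (1/d)) *\<^sub>R - (m / d))) ` cbox (-1/2) (1/2))"
    using d by (intro has_integral_affinity) auto
  moreover have "(\<lambda>x. (1 / (1/d)) *\<^sub>R x + - ((1 / (1/d)) *\<^sub>R - (m / d))) ` cbox (-1/2) (1/2)
      = cell a d i"
  proof -
    have "(\<lambda>x. (1 / (1/d)) *\<^sub>R x + - ((1 / (1/d)) *\<^sub>R - (m / d))) ` cbox (-1/2) (1/2)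
        = (\<lambda>x. d * x + m) ` {-1/2..1/2}"
      using d by simp
    also have "\<dots> = cell a d i"
      using d by (subst image_affinity_atLeastAtMost)
        (auto simp: cell_def m_def face_def field_simps)
    finally show ?thesis .
  qed
  moreover have "poly P ((1/d) *\<^sub>R x + - (m / d)) = poly p x" for x
    unfolding P_def poly_pcompose using d by (simp add: field_simps)
  ultimately have "((poly p) has_integral d * integral {-1/2..1/2} (poly P)) (cell a d i)"
    using d by simp
  then have "integral (cell a d i) (poly p) = d * integral {-1/2..1/2} (poly P)"
    by (rule integral_unique)
  moreover have "integral (cell a d i) F = integral (cell a d i) (poly p)"
    by (rule integral_cong) (rule p(2))
  moreover have "integral {-1/2..1/2} (poly P) = (\<Sum>r=1..N. \<omega> r * poly P (\<xi> r))"
    using ex \<open>degree P \<le> k\<close> by (simp add: exact_rule_def)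
  moreover have "\<dots> = (\<Sum>r=1..N. \<omega> r * F (node a d i (\<xi> r)))"
  proof (rule sum.cong)
    fix r assume "r \<in> {1..N}"
    then have "node a d i (\<xi> r) \<in> cell a d i"
      by (intro node_in_cell[OF d] exact_rule_node[OF ex])
    then show "\<omega> r * poly P (\<xi> r) = \<omega> r * F (node a d i (\<xi> r))"
      by (simp add: P p(2))
  qed simp
  ultimately show ?thesis by simp
qed

text \<open>A polynomial on the closed cell is continuous up to its ends, so the one-sided limits in
  the traces are plain values.\<close>

lemma Lim_at_left_face:
  assumes d: "0 < d" and F: "poly_on k (cell a d i) F"
  shows "Lim (at_left (face a d i)) F = F (face a d i)"
proof (rule tendsto_Lim)
  show "(F \<longlongrightarrow> F (face a d i)) (at_left (face a d i))"
    using poly_on_continuous[OF F] face_less[OF d, of a i]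
    by (auto simp: cell_def continuous_on_Icc_at_leftD)
qed simp

lemma Lim_at_right_face:
  assumes d: "0 < d" and F: "poly_on k (cell a d i) F"
  shows "Lim (at_right (face a d (i - 1))) F = F (face a d (i - 1))"
proof (rule tendsto_Lim)
  show "(F \<longlongrightarrow> F (face a d (i - 1))) (at_right (face a d (i - 1)))"
    using poly_on_continuous[OF F] face_less[OF d, of a i]
    by (auto simp: cell_def continuous_on_Icc_at_rightD)
qed simp


section \<open>Polynomials in two variables\<close>

text \<open>Degree at most \<open>k\<close> in each variable: weaker than total degree, and evidently symmetric.\<close>

definition biv_poly_on ::
    "nat \<Rightarrow> real set \<Rightarrow> real set \<Rightarrow> (real \<Rightarrow> real \<Rightarrow> real) \<Rightarrow> bool" where
  "biv_poly_on k I J f \<longleftrightarrow>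
     (\<exists>c :: nat \<Rightarrow> nat \<Rightarrow> real. \<forall>x\<in>I. \<forall>y\<in>J.
        f x y = (\<Sum>m\<le>k. \<Sum>n\<le>k. c m n * x ^ m * y ^ n))"

lemma polynomial2_on_imp_biv:
  assumes "polynomial2_on k I J f"
  shows "biv_poly_on k I J f"
proof -
  obtain c where c: "\<And>x y. x \<in> I \<Longrightarrow> y \<in> J \<Longrightarrow>
      f x y = (\<Sum>m\<le>k. \<Sum>n\<le>k - m. c m n * x ^ m * y ^ n)"
    using assms by (auto simp: polynomial2_on_def)
  \<comment> \<open>Coefficients beyond total degree \<open>k\<close> are padded with zeros.\<close>
  have "(\<Sum>n\<le>k - m. c m n * x ^ m * y ^ n)
      = (\<Sum>n\<le>k. (if n \<le> k - m then c m n else 0) * x ^ m * y ^ n)" for m and x y :: real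
    by (rule sum.mono_neutral_cong_left) auto
  with c have "\<forall>x\<in>I. \<forall>y\<in>J. f x y =
      (\<Sum>m\<le>k. \<Sum>n\<le>k. (if n \<le> k - m then c m n else 0) * x ^ m * y ^ n)"
    by simp
  then show ?thesis 
    unfolding biv_poly_on_def by (intro exI[of _ "\<lambda>m n. if n \<le> k - m then c m n else 0"])
qed

lemma biv_poly_on_transpose: "biv_poly_on k I J f \<Longrightarrow> biv_poly_on k J I (\<lambda>y x. f x y)"
  unfolding biv_poly_on_def
proof (elim exE)
  fix c :: "nat \<Rightarrow> nat \<Rightarrow> real"
  assume c: "\<forall>x\<in>I. \<forall>y\<in>J. f x y = (\<Sum>m\<le>k. \<Sum>n\<le>k. c m n * x ^ m * y ^ n)"
  show "\<exists>c. \<forall>y\<in>J. \<forall>x\<in>I. f x y = (\<Sum>m\<le>k. \<Sum>n\<le>k. c m n * y ^ m * x ^ n)"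
  proof (intro exI ballI)
    fix x y assume "y \<in> J" "x \<in> I"
    then have "f x y = (\<Sum>m\<le>k. \<Sum>n\<le>k. c m n * x ^ m * y ^ n)" using c by blast
    also have "\<dots> = (\<Sum>m\<le>k. \<Sum>n\<le>k. c n m * y ^ m * x ^ n)"
      by (subst sum.swap) (simp add: mult_ac)
    finally show "f x y = (\<Sum>m\<le>k. \<Sum>n\<le>k. c n m * y ^ m * x ^ n)" .
  qed
qed

lemma biv_poly_on_snd:
  assumes "biv_poly_on k I J f" "x \<in> I"
  shows "poly_on k J (f x)"
proof -
  obtain c where c: "\<And>y. y \<in> J \<Longrightarrow> f x y = (\<Sum>m\<le>k. \<Sum>n\<le>k. c m n * x ^ m * y ^ n)"
    using assms by (auto simp: biv_poly_on_def)
  have "poly_on k J (\<lambda>y. \<Sum>m\<le>k. \<Sum>n\<le>k. c m n * x ^ m * y ^ n)"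
    by (intro poly_on_sum poly_on_cmult poly_on_power) simp
  then show ?thesis using c by (rule poly_on_cong)
qed

lemma biv_poly_on_fst: "biv_poly_on k I J f \<Longrightarrow> y \<in> J \<Longrightarrow> poly_on k I (\<lambda>x. f x y)"
  using biv_poly_on_snd[OF biv_poly_on_transpose] .

lemma biv_poly_on_continuous:
  assumes "biv_poly_on k I J f"
  shows "continuous_on (I \<times> J) (\<lambda>(x, y). f x y)"
proof -
  obtain c where c: "\<And>x y. x \<in> I \<Longrightarrow> y \<in> J \<Longrightarrow>
      f x y = (\<Sum>m\<le>k. \<Sum>n\<le>k. c m n * x ^ m * y ^ n)"
    using assms by (auto simp: biv_poly_on_def)
  have "continuous_on (I \<times> J) (\<lambda>z. \<Sum>m\<le>k. \<Sum>n\<le>k. c m n * fst z ^ m * snd z ^ n)"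
    by (intro continuous_intros)
  then show ?thesis
    by (rule continuous_on_eq) (auto simp: c)
qed

lemma cell_Times_cbox:
  "cell a dx i \<times> cell b dy j =
    cbox (face a dx (i - 1), face b dy (j - 1)) (face a dx i, face b dy j)"
  by (simp add: cell_def cbox_Pair_eq)

lemma integral_cell_Times:
  assumes "biv_poly_on k (cell a dx i) (cell b dy j) f"
  shows "integral (cell a dx i \<times> cell b dy j) (\<lambda>(x, y). f x y) =
      integral (cell a dx i) (\<lambda>x. integral (cell b dy j) (f x))"
  using biv_poly_on_continuous[OF assms] unfolding cell_Times_cbox
  by (subst integral_prod_continuous) (auto simp: cell_def)

lemma integral_cell_swap:
  assumes "biv_poly_on k (cell a dx i) (cell b dy j) f"
  shows "integral (cell a dx i) (\<lambda>x. integral (cell b dy j) (f x)) =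
      integral (cell b dy j) (\<lambda>y. integral (cell a dx i) (\<lambda>x. f x y))"
  using integral_swap_continuous[OF biv_poly_on_continuous[OF assms, unfolded cell_Times_cbox]]
  by (simp add: cell_def)

text \<open>Exchanges the coordinates, so that the estimate in the x-direction also serves the
  y-direction.\<close>

definition transp :: "dgfun \<Rightarrow> dgfun" where
  "transp q = (\<lambda>i j x y. q j i y x)"

lemma cell_average_transp:
  assumes "biv_poly_on k (cell a dx i) (cell b dy j) (q i j)"
  shows "cell_average b dy a dx (transp q) j i = cell_average a dx b dy q i j"
  using integral_cell_Times[OF assms] integral_cell_swap[OF assms]
    integral_cell_Times[OF biv_poly_on_transpose[OF assms]]
  by (simp add: cell_average_def transp_def mult.commute)

lemma flux_y_transp: "flux_y b dy \<alpha> h v i j = flux_x b dy \<alpha> (transp h) (transp v) j i"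
  by (simp add: fun_eq_iff flux_x_def flux_y_def trace_xm_def trace_xp_def trace_ym_def
      trace_yp_def transp_def mult_dg_def)


section \<open>Bounding the cell average by edge values\<close>

text \<open>Gauss-Lobatto in x and Gauss in y express the average exactly as a sum of nonnegative
  terms. Dropping the interior Lobatto nodes leaves the two edges, both with weight
  \<open>\<omega>h 1\<close>.\<close>

lemma cell_average_ge_edges:
  assumes d: "0 < dx" "0 < dy"
    and ga: "gauss_rule L \<xi> \<omega>" "k \<le> 2 * L - 1"
    and gl: "gauss_lobatto_rule M \<zeta> \<omega>h" "k \<le> 2 * M - 3"
    and q: "biv_poly_on k (cell a dx i) (cell b dy j) (q i j)"
    and nonneg: "\<And>r \<beta>. r \<in> {1..M} \<Longrightarrow> \<beta> \<in> {1..L} \<Longrightarrow>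
        0 \<le> q i j (node a dx i (\<zeta> r)) (node b dy j (\<xi> \<beta>))"
  shows "\<omega>h 1 * (\<Sum>\<beta>=1..L. \<omega> \<beta> * (q i j (face a dx i) (node b dy j (\<xi> \<beta>))
            + q i j (face a dx (i - 1)) (node b dy j (\<xi> \<beta>))))
      \<le> cell_average a dx b dy q i j"
proof -
  have M: "M \<ge> 2" and e: "\<zeta> 1 = -1/2" "\<zeta> M = 1/2"
    using gl by (auto simp: gauss_lobatto_rule_def)
  have exL: "exact_rule k L \<xi> \<omega>"
    using exact_rule_mono[OF gauss_rule_exact[OF ga(1)] ga(2)] .
  have exM: "exact_rule k M \<zeta> \<omega>h"
    using exact_rule_mono[OF gauss_lobatto_rule_exact[OF gl(1)] gl(2)] .
  have nodeM: "node a dx i (\<zeta> r) \<in> cell a dx i" if "r \<in> {1..M}" for r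
    by (intro node_in_cell[OF d(1)] exact_rule_node[OF exM] that)
  let ?Q = "\<lambda>r \<beta>. q i j (node a dx i (\<zeta> r)) (node b dy j (\<xi> \<beta>))"
  have inner: "integral (cell a dx i) (\<lambda>x. q i j x y)
      = dx * (\<Sum>r=1..M. \<omega>h r * q i j (node a dx i (\<zeta> r)) y)" if "y \<in> cell b dy j" for y
    using integral_cell_eq[OF d(1) exM biv_poly_on_fst[OF q that]] .
  \<comment> \<open>The x-integral is made the inner one, so that the Lobatto rule applies for each
    fixed y and leaves a polynomial in y.\<close>
  have "integral (cell a dx i \<times> cell b dy j) (\<lambda>(x, y). q i j x y)
      = integral (cell b dy j) (\<lambda>y. integral (cell a dx i) (\<lambda>x. q i j x y))"
    using integral_cell_Times[OF q] integral_cell_swap[OF q] by simp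
  also have "\<dots> = integral (cell b dy j)
      (\<lambda>y. dx * (\<Sum>r=1..M. \<omega>h r * q i j (node a dx i (\<zeta> r)) y))"
    by (rule integral_cong) (rule inner)
  also have "\<dots> = dy * (\<Sum>\<beta>=1..L. \<omega> \<beta> * (dx * (\<Sum>r=1..M. \<omega>h r * ?Q r \<beta>)))"
    by (rule integral_cell_eq[OF d(2) exL])
      (intro poly_on_sum poly_on_cmult biv_poly_on_snd[OF q] nodeM)
  also have "\<dots> = (dx * dy) * (\<Sum>\<beta>=1..L. \<omega> \<beta> * (\<Sum>r=1..M. \<omega>h r * ?Q r \<beta>))"
    by (simp add: sum_distrib_left mult_ac)
  finally have avg: "cell_average a dx b dy q i j
      = (\<Sum>\<beta>=1..L. \<omega> \<beta> * (\<Sum>r=1..M. \<omega>h r * ?Q r \<beta>))"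
    using d by (simp add: cell_average_def)
  have "\<omega>h 1 * (?Q M \<beta> + ?Q 1 \<beta>) \<le> (\<Sum>r=1..M. \<omega>h r * ?Q r \<beta>)" if \<beta>: "\<beta> \<in> {1..L}" for \<beta>
  proof -
    \<comment> \<open>The two end nodes are distinct, as M is at least 2, and their weights
      agree.\<close>
    have "\<omega>h 1 * (?Q M \<beta> + ?Q 1 \<beta>) = (\<Sum>r\<in>{1, M}. \<omega>h r * ?Q r \<beta>)"
      using M gauss_lobatto_end_weights_eq[OF gl(1)] by (simp add: algebra_simps)
    also have "\<dots> \<le> (\<Sum>r=1..M. \<omega>h r * ?Q r \<beta>)"
    proof (rule sum_mono2)
      fix r assume "r \<in> {1..M} - {1, M}"
      then show "0 \<le> \<omega>h r * ?Q r \<beta>"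
        using gauss_lobatto_weight_pos[OF gl(1), of r] nonneg[OF _ \<beta>, of r] by simp
    qed (use M in auto)
    finally show ?thesis .
  qed
  then have "(\<Sum>\<beta>=1..L. \<omega> \<beta> * (\<omega>h 1 * (?Q M \<beta> + ?Q 1 \<beta>))) \<le> cell_average a dx b dy q i j"
    unfolding avg
    by (intro sum_mono mult_left_mono less_imp_le[OF gauss_rule_weight_pos[OF ga(1)]])
  then show ?thesis
    unfolding e node_ends by (simp add: sum_distrib_left mult_ac)
qed

text \<open>The flux splits into (mm + \<alpha> hm)/2, which lies between 0 and \<alpha> hm, and (mp
  - \<alpha> hp)/2, which lies between -\<alpha> hp and 0.\<close>

lemma lax_friedrichs_bounds:
  fixes mm mp hm hp \<alpha> :: real
  assumes "\<bar>mm\<bar> \<le> \<alpha> * hm" "\<bar>mp\<bar> \<le> \<alpha> * hp"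
  shows "1/2 * (mm + mp - \<alpha> * (hp - hm)) \<le> \<alpha> * hm"
    and "- (\<alpha> * hp) \<le> 1/2 * (mm + mp - \<alpha> * (hp - hm))"
proof -
  have "- (\<alpha> * hm) \<le> mm" "mm \<le> \<alpha> * hm" "- (\<alpha> * hp) \<le> mp" "mp \<le> \<alpha> * hp"
    using assms by linarith+
  then show "1/2 * (mm + mp - \<alpha> * (hp - hm)) \<le> \<alpha> * hm"
    and "- (\<alpha> * hp) \<le> 1/2 * (mm + mp - \<alpha> * (hp - hm))"
    by (auto simp: right_diff_distrib field_simps)
qed

lemma flux_x_on_edge:
  assumes d: "0 < dx" and y: "y \<in> cell b dy j"
    and P: "\<And>i'. i' \<in> {i, i + 1} \<Longrightarrow> biv_poly_on k (cell a dx i') (cell b dy j) (h i' j) \<and>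
        biv_poly_on k (cell a dx i') (cell b dy j) (mult_dg h u i' j)"
  shows "flux_x a dx \<alpha> h u i j y =
    1/2 * (mult_dg h u i j (face a dx i) y + mult_dg h u (i + 1) j (face a dx i) y
      - \<alpha> * (h (i + 1) j (face a dx i) y - h i j (face a dx i) y))"
proof -
  have "trace_xm a dx q i j y = q i j (face a dx i) y"
    if "biv_poly_on k (cell a dx i) (cell b dy j) (q i j)" for q
    unfolding trace_xm_def by (rule Lim_at_left_face[OF d biv_poly_on_fst[OF that y]])
  moreover have "trace_xp a dx q i j y = q (i + 1) j (face a dx i) y"
    if "biv_poly_on k (cell a dx (i + 1)) (cell b dy j) (q (i + 1) j)" for q
    using Lim_at_right_face[OF d biv_poly_on_fst[OF that y]] by (simp add: trace_xp_def)
  ultimately show ?thesis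
    using P by (simp add: flux_x_def)
qed

text \<open>The flux difference is polynomial in y, hence its edge integral is a Gauss sum. At each
  Gauss node it is at most \<alpha> times the two inner traces of the depth, and
  \<open>cell_average_ge_edges\<close> bounds their weighted sum.\<close>

lemma flux_x_difference_le:
  assumes d: "0 < dx" "0 < dy"
    and ga: "gauss_rule L \<xi> \<omega>" "k \<le> 2 * L - 1"
    and gl: "gauss_lobatto_rule M \<zeta> \<omega>h" "k \<le> 2 * M - 3"
    and P: "\<And>i'. i' \<in> {i - 1, i, i + 1} \<Longrightarrow>
        biv_poly_on k (cell a dx i') (cell b dy j) (h i' j) \<and>
        biv_poly_on k (cell a dx i') (cell b dy j) (mult_dg h u i' j)"
    and \<alpha>: "0 \<le> \<alpha>"
    and speed: "\<And>i' x y. i' \<in> {i - 1, i, i + 1} \<Longrightarrow> x \<in> cell a dx i' \<Longrightarrow> y \<in> cell b dy j \<Longrightarrow>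
        0 \<le> h i' j x y \<Longrightarrow> \<bar>u i' j x y\<bar> \<le> \<alpha>"
    and nonneg: "\<And>r \<beta>. r \<in> {1..M} \<Longrightarrow> \<beta> \<in> {1..L} \<Longrightarrow>
        0 \<le> h i j (node a dx i (\<zeta> r)) (node b dy j (\<xi> \<beta>))"
    and left: "\<And>\<beta>. \<beta> \<in> {1..L} \<Longrightarrow>
        0 \<le> h (i - 1) j (face a dx (i - 1)) (node b dy j (\<xi> \<beta>))"
    and right: "\<And>\<beta>. \<beta> \<in> {1..L} \<Longrightarrow>
        0 \<le> h (i + 1) j (face a dx i) (node b dy j (\<xi> \<beta>))"
  shows "\<omega>h 1 * integral (cell b dy j)
      (\<lambda>y. flux_x a dx \<alpha> h u i j y - flux_x a dx \<alpha> h u (i - 1) j y)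
    \<le> dy * \<alpha> * cell_average a dx b dy h i j"
proof -
  have M: "M \<ge> 2" and e: "\<zeta> 1 = -1/2" "\<zeta> M = 1/2"
    using gl by (auto simp: gauss_lobatto_rule_def)
  have exL: "exact_rule k L \<xi> \<omega>"
    using exact_rule_mono[OF gauss_rule_exact[OF ga(1)] ga(2)] .
  have faces: "face a dx i \<in> cell a dx i" "face a dx (i - 1) \<in> cell a dx i"
    "face a dx (i - 1) \<in> cell a dx (i - 1)" "face a dx i \<in> cell a dx (i + 1)"
    using d by (auto simp: cell_def face_def)
  let ?D = "\<lambda>y. flux_x a dx \<alpha> h u i j y - flux_x a dx \<alpha> h u (i - 1) j y"
  let ?m = "mult_dg h u" and ?xr = "face a dx i" and ?xl = "face a dx (i - 1)"
  have R: "flux_x a dx \<alpha> h u i j y = 1/2 * (?m i j ?xr y + ?m (i + 1) j ?xr y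
      - \<alpha> * (h (i + 1) j ?xr y - h i j ?xr y))" if "y \<in> cell b dy j" for y
    by (rule flux_x_on_edge[OF d(1) that]) (use P in auto)
  have Lf: "flux_x a dx \<alpha> h u (i - 1) j y = 1/2 * (?m (i - 1) j ?xl y + ?m i j ?xl y
      - \<alpha> * (h i j ?xl y - h (i - 1) j ?xl y))" if "y \<in> cell b dy j" for y
  proof -
    have "biv_poly_on k (cell a dx i') (cell b dy j) (h i' j) \<and>
        biv_poly_on k (cell a dx i') (cell b dy j) (mult_dg h u i' j)"
      if "i' \<in> {i - 1, i - 1 + 1}" for i'
      using P that by auto
    from flux_x_on_edge[where i = "i - 1", OF d(1) that this] show ?thesis by simp
  qed
  have "poly_on k (cell b dy j) (\<lambda>y.
      1/2 * (?m i j ?xr y + ?m (i + 1) j ?xr y - \<alpha> * (h (i + 1) j ?xr y - h i j ?xr y))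
      - 1/2 * (?m (i - 1) j ?xl y + ?m i j ?xl y - \<alpha> * (h i j ?xl y - h (i - 1) j ?xl y)))"
    using P faces
    by (intro poly_on_diff poly_on_cmult poly_on_add; blast intro: biv_poly_on_snd)
  then have "poly_on k (cell b dy j) ?D"
    by (rule poly_on_cong) (simp add: R Lf)
  then have "integral (cell b dy j) ?D = dy * (\<Sum>\<beta>=1..L. \<omega> \<beta> * ?D (node b dy j (\<xi> \<beta>)))"
    by (rule integral_cell_eq[OF d(2) exL])
  also have "\<dots> \<le> dy * (\<Sum>\<beta>=1..L. \<omega> \<beta> * (\<alpha> *
      (h i j ?xr (node b dy j (\<xi> \<beta>)) + h i j ?xl (node b dy j (\<xi> \<beta>)))))"
  proof (intro mult_left_mono sum_mono)
    fix \<beta> assume \<beta>: "\<beta> \<in> {1..L}"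
    let ?y = "node b dy j (\<xi> \<beta>)"
    have y: "?y \<in> cell b dy j"
      by (intro node_in_cell[OF d(2)] exact_rule_node[OF exL] \<beta>)
    \<comment> \<open>The velocity is controlled only where the depth is nonnegative, so the sign of
      each trace has to be known first.\<close>
    have mom: "\<bar>?m i' j x ?y\<bar> \<le> \<alpha> * h i' j x ?y"
      if "i' \<in> {i - 1, i, i + 1}" "x \<in> cell a dx i'" "0 \<le> h i' j x ?y" for i' x
      using mult_right_mono[OF speed[OF that(1,2) y that(3)] that(3)] that(3)
      by (simp add: mult_dg_def abs_mult mult.commute)
    have "0 \<le> h i j ?xr ?y" "0 \<le> h i j ?xl ?y"
      using nonneg[OF _ \<beta>, of M] nonneg[OF _ \<beta>, of 1] M unfolding e node_ends by simp_all
    \<comment> \<open>The inner state is the left one at the right edge and the right one at the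
      left edge; hence an upper bound for the former flux and a lower bound for the latter.\<close>
    then have "flux_x a dx \<alpha> h u i j ?y \<le> \<alpha> * h i j ?xr ?y"
      "- (\<alpha> * h i j ?xl ?y) \<le> flux_x a dx \<alpha> h u (i - 1) j ?y"
      unfolding R[OF y] Lf[OF y]
      by (intro lax_friedrichs_bounds mom; use left[OF \<beta>] right[OF \<beta>] faces in simp)+
    then show "?D ?y \<le> \<alpha> * (h i j ?xr ?y + h i j ?xl ?y)"
      by (simp add: distrib_left)
  qed (use d gauss_rule_weight_pos[OF ga(1)] in \<open>auto intro: less_imp_le\<close>)
  also have "\<dots> = dy * \<alpha> * (\<Sum>\<beta>=1..L. \<omega> \<beta> *
      (h i j ?xr (node b dy j (\<xi> \<beta>)) + h i j ?xl (node b dy j (\<xi> \<beta>))))"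
    by (simp add: sum_distrib_left mult_ac)
  finally have "\<omega>h 1 * integral (cell b dy j) ?D \<le> \<omega>h 1 * \<dots>"
    using gauss_lobatto_weight_pos[OF gl(1), of 1] M by (intro mult_left_mono) auto
  also have "\<dots> = dy * \<alpha> * (\<omega>h 1 * (\<Sum>\<beta>=1..L. \<omega> \<beta> *
      (h i j ?xr (node b dy j (\<xi> \<beta>)) + h i j ?xl (node b dy j (\<xi> \<beta>)))))"
    by (simp only: mult_ac)
  also have "\<dots> \<le> dy * \<alpha> * cell_average a dx b dy h i j"
    by (intro mult_left_mono cell_average_ge_edges[OF d ga gl] nonneg) (use P d \<alpha> in auto)
  finally show ?thesis .
qed

section \<open>Both directions combined under the time step restriction\<close>

theorem theorem2:
  fixes a b dx dy dt g \<alpha>1 \<alpha>2 :: real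
    and Mx My k L M :: nat
    and \<xi> \<omega> \<zeta> \<omega>h :: "nat \<Rightarrow> real"
    and h u v :: dgfun
    and hbar_new :: "int \<Rightarrow> int \<Rightarrow> real"
  assumes pos: "0 < dx" "0 < dy" "0 < dt" "0 < g"
    and gauss: "gauss_rule L \<xi> \<omega>" "k \<le> 2 * L - 1"
    and lobatto: "gauss_lobatto_rule M \<zeta> \<omega>h" "2 * M - 3 > k"
    and polynomials: "\<And>i j. (i, j) \<in> state_cells Mx My \<Longrightarrow>
        polynomial2_on k (cell a dx i) (cell b dy j) (h i j) \<and>
        polynomial2_on k (cell a dx i) (cell b dy j) (mult_dg h u i j) \<and>
        polynomial2_on k (cell a dx i) (cell b dy j) (mult_dg h v i j)"
    and update: "\<And>i j. (i, j) \<in> mesh_cells Mx My \<Longrightarrow>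
        hbar_new i j = cell_average a dx b dy h i j
          - dt / (dx * dy) * integral (cell b dy j)
              (\<lambda>y. flux_x a dx \<alpha>1 h u i j y - flux_x a dx \<alpha>1 h u (i - 1) j y)
          - dt / (dx * dy) * integral (cell a dx i)
              (\<lambda>x. flux_y b dy \<alpha>2 h v i j x - flux_y b dy \<alpha>2 h v i (j - 1) x)"
    and cond1: "\<And>i j. (i, j) \<in> mesh_cells Mx My \<Longrightarrow>
        0 \<le> cell_average a dx b dy h i j \<and>
        (\<forall>r\<in>{1..M}. \<forall>\<beta>\<in>{1..L}.
           0 \<le> h i j (node a dx i (\<xi> \<beta>)) (node b dy j (\<zeta> r)) \<and>
           0 \<le> h i j (node a dx i (\<zeta> r)) (node b dy j (\<xi> \<beta>)))"
    and cond1_exterior_x: "\<And>j \<beta>. j \<in> {1..int My} \<Longrightarrow> \<beta> \<in> {1..L} \<Longrightarrow>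
        0 \<le> trace_xm a dx h 0 j (node b dy j (\<xi> \<beta>)) \<and>
        0 \<le> trace_xp a dx h (int Mx) j (node b dy j (\<xi> \<beta>))"
    and cond1_exterior_y: "\<And>i \<beta>. i \<in> {1..int Mx} \<Longrightarrow> \<beta> \<in> {1..L} \<Longrightarrow>
        0 \<le> trace_ym b dy h i 0 (node a dx i (\<xi> \<beta>)) \<and>
        0 \<le> trace_yp b dy h i (int My) (node a dx i (\<xi> \<beta>))"
    and finite_norms: "bdd_above (wave_speeds a dx Mx b dy My g h u)"
        "bdd_above (wave_speeds a dx Mx b dy My g h v)"
    and \<alpha>1: "\<alpha>1 = Sup (wave_speeds a dx Mx b dy My g h u)"
    and \<alpha>2: "\<alpha>2 = Sup (wave_speeds a dx Mx b dy My g h v)"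
    and cond2: "dt / dx * \<alpha>1 + dt / dy * \<alpha>2 \<le> \<omega>h 1"
  shows "\<forall>i\<in>{1..int Mx}. \<forall>j\<in>{1..int My}. 0 \<le> hbar_new i j"
proof (intro ballI)
  fix i j assume i: "i \<in> {1..int Mx}" and j: "j \<in> {1..int My}"
  have M: "M \<ge> 2" and L: "L \<ge> 1" and e: "\<zeta> 1 = -1/2" "\<zeta> M = 1/2"
    using lobatto gauss by (auto simp: gauss_lobatto_rule_def gauss_rule_def)
  have kM: "k \<le> 2 * M - 3" using lobatto by simp
  have mesh: "(i', j') \<in> state_cells Mx My" if "(i', j') \<in> mesh_cells Mx My" for i' j'
    using that by (auto simp: mesh_cells_def state_cells_def)
  have xs: "(i', j) \<in> state_cells Mx My" if "i' \<in> {i - 1, i, i + 1}" for i'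
    using that i j by (auto simp: state_cells_def)
  have ys: "(i, j') \<in> state_cells Mx My" if "j' \<in> {j - 1, j, j + 1}" for j'
    using that i j by (auto simp: state_cells_def)
  have ij: "(i, j) \<in> mesh_cells Mx My" using i j by (simp add: mesh_cells_def)
  have P: "biv_poly_on k (cell a dx i') (cell b dy j') (h i' j')"
      "biv_poly_on k (cell a dx i') (cell b dy j') (mult_dg h u i' j')"
      "biv_poly_on k (cell a dx i') (cell b dy j') (mult_dg h v i' j')"
    if "(i', j') \<in> state_cells Mx My" for i' j'
    using polynomials[OF that] by (auto intro: polynomial2_on_imp_biv)
  have gnode: "\<xi> \<beta> \<in> {-1/2..1/2}" if "\<beta> \<in> {1..L}" for \<beta>
    by (rule exact_rule_node[OF gauss_rule_exact[OF gauss(1)] that])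
  have hx: "0 \<le> h i' j' (node a dx i' (\<zeta> r)) (node b dy j' (\<xi> \<beta>))"
    and hy: "0 \<le> h i' j' (node a dx i' (\<xi> \<beta>)) (node b dy j' (\<zeta> r))"
    if "(i', j') \<in> mesh_cells Mx My" "r \<in> {1..M}" "\<beta> \<in> {1..L}" for i' j' r \<beta>
    using cond1[OF that(1)] that(2,3) by auto
  \<comment> \<open>The square root is nonnegative at such points, so the supremum of the sums
    dominates the velocity alone.\<close>
  have speed: "\<bar>w i' j' x y\<bar> \<le> Sup (wave_speeds a dx Mx b dy My g h w)"
    if "bdd_above (wave_speeds a dx Mx b dy My g h w)" "(i', j') \<in> state_cells Mx My"
      "x \<in> cell a dx i'" "y \<in> cell b dy j'" "0 \<le> h i' j' x y" for w i' j' x y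
  proof -
    have "\<bar>w i' j' x y\<bar> + sqrt (g * h i' j' x y) \<in> wave_speeds a dx Mx b dy My g h w"
      using that unfolding wave_speeds_def by blast
    from cSup_upper[OF this that(1)]
    moreover have "0 \<le> sqrt (g * h i' j' x y)" using pos that(5) by simp
    ultimately show ?thesis by linarith
  qed
  \<comment> \<open>A point of nonnegative depth is needed to make the speed sets nonempty;
    otherwise their suprema would carry no information about sign.\<close>
  have "node a dx i (\<zeta> 1) \<in> cell a dx i" "node b dy j (\<xi> 1) \<in> cell b dy j"
    using e gnode L pos by (auto intro!: node_in_cell)
  moreover have "0 \<le> h i j (node a dx i (\<zeta> 1)) (node b dy j (\<xi> 1))"
    using hx[OF ij] M L by simp
  ultimately have \<alpha>_nonneg: "0 \<le> \<alpha>1" "0 \<le> \<alpha>2"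
    using speed[OF finite_norms(1) mesh[OF ij]] speed[OF finite_norms(2) mesh[OF ij]]
    unfolding \<alpha>1 \<alpha>2 by (meson abs_ge_zero order_trans)+

  \<comment> \<open>The outer trace belongs to a ghost cell when \<open>i = 1\<close>, where the
    exterior condition applies; otherwise it is the value at the last Lobatto node of the
    neighbouring cell. The next three facts follow the same pattern.\<close>
  have left_x: "0 \<le> h (i - 1) j (face a dx (i - 1)) (node b dy j (\<xi> \<beta>))"
    if \<beta>: "\<beta> \<in> {1..L}" for \<beta>
  proof (cases "i = 1")
    case True
    have "trace_xm a dx h 0 j (node b dy j (\<xi> \<beta>)) = h 0 j (face a dx 0) (node b dy j (\<xi> \<beta>))"
      unfolding trace_xm_def using P(1)[OF xs[of "i - 1"]] True pos gnode[OF \<beta>]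
      by (auto intro!: Lim_at_left_face biv_poly_on_fst node_in_cell)
    then show ?thesis using cond1_exterior_x[OF j \<beta>] True by simp
  next
    case False
    then have "(i - 1, j) \<in> mesh_cells Mx My" using i j by (auto simp: mesh_cells_def)
    from hx[OF this _ \<beta>, of M] show ?thesis using M unfolding e node_ends by simp
  qed
  have right_x: "0 \<le> h (i + 1) j (face a dx i) (node b dy j (\<xi> \<beta>))"
    if \<beta>: "\<beta> \<in> {1..L}" for \<beta>
  proof (cases "i = int Mx")
    case True
    have "trace_xp a dx h i j (node b dy j (\<xi> \<beta>)) = h (i + 1) j (face a dx i) (node b dy j (\<xi> \<beta>))"
      unfolding trace_xp_def
      using Lim_at_right_face[OF pos(1) biv_poly_on_fst[OF P(1)[OF xs[of "i + 1"]]
          node_in_cell[OF pos(2) gnode[OF \<beta>]]]] by simp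
    then show ?thesis using cond1_exterior_x[OF j \<beta>] True by simp
  next
    case False
    then have "(i + 1, j) \<in> mesh_cells Mx My" using i j by (auto simp: mesh_cells_def)
    from hx[OF this _ \<beta>, of 1] show ?thesis using M unfolding e node_ends by simp
  qed
  have left_y: "0 \<le> h i (j - 1) (node a dx i (\<xi> \<beta>)) (face b dy (j - 1))"
    if \<beta>: "\<beta> \<in> {1..L}" for \<beta>
  proof (cases "j = 1")
    case True
    have "trace_ym b dy h i 0 (node a dx i (\<xi> \<beta>)) = h i 0 (node a dx i (\<xi> \<beta>)) (face b dy 0)"
      unfolding trace_ym_def using P(1)[OF ys[of "j - 1"]] True pos gnode[OF \<beta>]
      by (auto intro!: Lim_at_left_face biv_poly_on_snd node_in_cell)
    then show ?thesis using cond1_exterior_y[OF i \<beta>] True by simp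
  next
    case False
    then have "(i, j - 1) \<in> mesh_cells Mx My" using i j by (auto simp: mesh_cells_def)
    from hy[OF this _ \<beta>, of M] show ?thesis using M unfolding e node_ends by simp
  qed
  have right_y: "0 \<le> h i (j + 1) (node a dx i (\<xi> \<beta>)) (face b dy j)"
    if \<beta>: "\<beta> \<in> {1..L}" for \<beta>
  proof (cases "j = int My")
    case True
    have "trace_yp b dy h i j (node a dx i (\<xi> \<beta>)) = h i (j + 1) (node a dx i (\<xi> \<beta>)) (face b dy j)"
      unfolding trace_yp_def
      using Lim_at_right_face[OF pos(2) biv_poly_on_snd[OF P(1)[OF ys[of "j + 1"]]
          node_in_cell[OF pos(1) gnode[OF \<beta>]]]] by simp
    then show ?thesis using cond1_exterior_y[OF i \<beta>] True by simp
  next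
    case False
    then have "(i, j + 1) \<in> mesh_cells Mx My" using i j by (auto simp: mesh_cells_def)
    from hy[OF this _ \<beta>, of 1] show ?thesis using M unfolding e node_ends by simp
  qed

  define H where "H = cell_average a dx b dy h i j"
  define FX where "FX = integral (cell b dy j)
      (\<lambda>y. flux_x a dx \<alpha>1 h u i j y - flux_x a dx \<alpha>1 h u (i - 1) j y)"
  define FY where "FY = integral (cell a dx i)
      (\<lambda>x. flux_y b dy \<alpha>2 h v i j x - flux_y b dy \<alpha>2 h v i (j - 1) x)"
  have FX: "\<omega>h 1 * FX \<le> dy * \<alpha>1 * H"
    unfolding FX_def H_def
    by (rule flux_x_difference_le[OF pos(1,2) gauss lobatto(1) kM])
      (use P xs speed[OF finite_norms(1) xs, folded \<alpha>1] \<alpha>_nonneg hx[OF ij] left_x right_x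
        in \<open>auto simp del: insert_iff\<close>)
  \<comment> \<open>The estimate for x is applied to the transposed data, with the roles of the mesh
    widths and indices exchanged.\<close>
  have "\<omega>h 1 * FY \<le> dx * \<alpha>2 * cell_average b dy a dx (transp h) j i"
    unfolding FY_def flux_y_transp
  proof (rule flux_x_difference_le[OF pos(2,1) gauss lobatto(1) kM])
    fix j' assume "j' \<in> {j - 1, j, j + 1}"
    note s = ys[OF this]
    show "biv_poly_on k (cell b dy j') (cell a dx i) (transp h j' i) \<and>
        biv_poly_on k (cell b dy j') (cell a dx i) (mult_dg (transp h) (transp v) j' i)"
      using biv_poly_on_transpose[OF P(1)[OF s]] biv_poly_on_transpose[OF P(3)[OF s]]
      by (simp add: transp_def mult_dg_def)
    fix x y assume "x \<in> cell b dy j'" "y \<in> cell a dx i" "0 \<le> transp h j' i x y"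
    then show "\<bar>transp v j' i x y\<bar> \<le> \<alpha>2"
      using speed[OF finite_norms(2) s] by (simp add: \<alpha>2 transp_def)
  qed (use \<alpha>_nonneg hy[OF ij] left_y right_y in \<open>simp_all add: transp_def\<close>)
  then have FY: "\<omega>h 1 * FY \<le> dx * \<alpha>2 * H"
    unfolding H_def cell_average_transp[where q = h, OF P(1)[OF mesh[OF ij]]] .

  have H: "0 \<le> H" using cond1[OF ij] by (simp add: H_def)
  have new: "hbar_new i j = H - dt / (dx * dy) * FX - dt / (dx * dy) * FY"
    using update[OF ij] by (simp add: H_def FX_def FY_def)
  \<comment> \<open>The chain bounds \<open>\<omega>h 1 * hbar_new i j\<close> from below; keeping
    the factor avoids division by the weight, whose positivity settles the sign at the end.\<close>
  have "0 \<le> (\<omega>h 1 - (dt / dx * \<alpha>1 + dt / dy * \<alpha>2)) * H"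
    using cond2 H by simp
  also have "\<dots> = \<omega>h 1 * H - dt / (dx * dy) * (dy * \<alpha>1 * H) - dt / (dx * dy) * (dx * \<alpha>2 * H)"
    using pos by (simp add: field_simps)
  also have "\<dots> \<le> \<omega>h 1 * H - dt / (dx * dy) * (\<omega>h 1 * FX) - dt / (dx * dy) * (\<omega>h 1 * FY)"
    using pos by (intro diff_mono mult_left_mono FX FY order_refl) auto
  also have "\<dots> = \<omega>h 1 * hbar_new i j"
    by (simp add: new algebra_simps)
  finally show "0 \<le> hbar_new i j"
    using gauss_lobatto_weight_pos[OF lobatto(1), of 1] M by (simp add: zero_le_mult_iff)
qed

end
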